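(* Let $f$ be a closed relation on a compact Hausdorff space $X$. Let $K$ be a subset of $X$. (a) Assume $K$ is closed and $\mathcal Cf$ $^+$invariant. If $G$ is an open set which contains $K$, then there exists an open inward set $A$ (for $f$) with $K\subset A\subset G$ and there exists an elementary Lyapunov function $L:X\to[0,1]$ for $f$ such that $L=0$ on $X\setminus G$ and $L=1$ on $K$. In particular, the open inward sets which contain a closed, $\mathcal Cf$ $^+$invariant set form a neighborhood base of the set. The intersection $K\cap|\mathcal Cf|$ is a closed, $\mathcal Cf\cap(|\mathcal Cf|\times|\mathcal Cf|)$ invariant subset of $|\mathcal Cf|$. (b) If $K$ is closed, then the following conditions are equivalent. (i) $K$ is $\mathcal Cf$ $^+$invariant and is $f$ invariant. (ii) $K$ is $\mathcal Cf$ invariant. (iii) $K=\mathcal Cf(K\cap|\mathcal Cf|)$. (iv) $K$ is $\mathcal Cf$ $^+$invariant and if $A$ is an inward set which contains $K$ then the associated attractor $A_\infty$ contains $K$. (c) $K$ is an attractor iff $K$ is closed, $\mathcal Cf$ invariant and $K\cap|\mathcal Cf|$ is a clopen subset of $|\mathcal Cf|$. Conversely, if $A_0$ is a clopen $\mathcal Cf\cap(|\mathcal Cf|\times|\mathcal Cf|)$ invariant subset of $|\mathcal Cf|$, then $K_0=\mathcal Cf(A_0)$ is an attractor of which $A_0$ is the trace.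
   Context: A relation on $X$ is a subset of $X\times X$; it is closed if it is closed in $X\times X$. $F(A)=\{y:(x,y)\in F\text{ for some }x\in A\}$; $|F|=\{x:(x,x)\in F\}$; $A$ is $F$ $^+$invariant if $F(A)\subset A$ and $F$ invariant if $F(A)=A$. $\mathcal Cf$ is the Conley chain relation for the unique uniformity of $X$ (all neighborhoods of the diagonal): $(x,y)\in\mathcal Cf$ iff for every neighborhood $U$ of the diagonal there are $n\ge1$ and $(a_1,b_1),\dots,(a_n,b_n)\in f$ with $(x,a_1),(b_1,a_2),\dots,(b_{n-1},a_n),(b_n,y)\in U$. A set $A\subset X$ is inward (for $f$) if $U(f(A))\subset A$ for some neighborhood $U$ of the diagonal; equivalently $\overline{f(A)}\subset A^\circ$. An elementary Lyapunov function for $f$ is a continuous $L:X\to[0,1]$ such that $(x,y)\in f$ and $L(x)>0$ imply $L(y)=1$. For an inward set $A$, the associated attractor $A_\infty$ is the maximum $\mathcal Cf$ invariant subset of $A$, i.e. the union of all $\mathcal Cf$ invariant subsets of $A$; an attractor is a set of the form $A_\infty$ for some inward $A$. The trace of a closed $\mathcal Cf$ invariant set $K$ is $K\cap|\mathcal Cf|$. *)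

theory Defs
  imports "HOL-Analysis.Analysis"
begin

text \<open>
  A space is an abstract topology \<open>X\<close> with point set \<open>topspace X\<close>.
  A relation on \<open>X\<close> is a set \<open>F\<close> of pairs of points of \<open>X\<close>; the image \<open>F(A)\<close> is \<open>F `` A\<close>.
\<close>

definition cyclic_set :: "('a \<times> 'a) set \<Rightarrow> 'a set" where
  "cyclic_set F = {x. (x, x) \<in> F}"

definition plus_invariant :: "('a \<times> 'a) set \<Rightarrow> 'a set \<Rightarrow> bool" where
  "plus_invariant F A \<longleftrightarrow> F `` A \<subseteq> A"

definition invariant :: "('a \<times> 'a) set \<Rightarrow> 'a set \<Rightarrow> bool" where
  "invariant F A \<longleftrightarrow> F `` A = A"

text \<open>On a compact Hausdorff space these sets are exactly the entourages of the unique uniformity.\<close>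

definition diag_nbhd :: "'a topology \<Rightarrow> ('a \<times> 'a) set \<Rightarrow> bool" where
  "diag_nbhd X U \<longleftrightarrow>
     U \<subseteq> topspace X \<times> topspace X \<and> Id_on (topspace X) \<subseteq> (prod_topology X X) interior_of U"

definition conley :: "'a topology \<Rightarrow> ('a \<times> 'a) set \<Rightarrow> ('a \<times> 'a) set" where
  "conley X f = {(x, y). x \<in> topspace X \<and> y \<in> topspace X \<and>
     (\<forall>U. diag_nbhd X U \<longrightarrow>
        (\<exists>(n::nat) a b. n \<ge> 1 \<and> (\<forall>i\<in>{1..n}. (a i, b i) \<in> f) \<and>
           (x, a 1) \<in> U \<and> (\<forall>i\<in>{1..<n}. (b i, a (Suc i)) \<in> U) \<and> (b n, y) \<in> U))}"

text \<open>Inward sets are arbitrary subsets of the space, neither open nor closed in general.\<close>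

definition inward :: "'a topology \<Rightarrow> ('a \<times> 'a) set \<Rightarrow> 'a set \<Rightarrow> bool" where
  "inward X f A \<longleftrightarrow> A \<subseteq> topspace X \<and> (\<exists>U. diag_nbhd X U \<and> U `` (f `` A) \<subseteq> A)"

definition elem_lyapunov :: "'a topology \<Rightarrow> ('a \<times> 'a) set \<Rightarrow> ('a \<Rightarrow> real) \<Rightarrow> bool" where
  "elem_lyapunov X f L \<longleftrightarrow>
     continuous_map X (top_of_set {0..1}) L \<and> (\<forall>(x, y)\<in>f. L x > 0 \<longrightarrow> L y = 1)"

definition assoc_attractor :: "'a topology \<Rightarrow> ('a \<times> 'a) set \<Rightarrow> 'a set \<Rightarrow> 'a set" where
  "assoc_attractor X f A = \<Union>{B. B \<subseteq> A \<and> invariant (conley X f) B}"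

definition attractor :: "'a topology \<Rightarrow> ('a \<times> 'a) set \<Rightarrow> 'a set \<Rightarrow> bool" where
  "attractor X f K \<longleftrightarrow> (\<exists>A. inward X f A \<and> K = assoc_attractor X f A)"

definition chain_trace :: "'a topology \<Rightarrow> ('a \<times> 'a) set \<Rightarrow> 'a set \<Rightarrow> 'a set" where
  "chain_trace X f K = K \<inter> cyclic_set (conley X f)"

definition conley_cyclic :: "'a topology \<Rightarrow> ('a \<times> 'a) set \<Rightarrow> ('a \<times> 'a) set" where
  "conley_cyclic X f =
     conley X f \<inter> (cyclic_set (conley X f) \<times> cyclic_set (conley X f))"

definition clopenin :: "'a topology \<Rightarrow> 'a set \<Rightarrow> bool" where
  "clopenin X S \<longleftrightarrow> openin X S \<and> closedin X S"

text \<open>Neighborhood bases of a set \<open>K\<close>; members are neighborhoods, not necessarily open.\<close>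

definition set_nbhd :: "'a topology \<Rightarrow> 'a set \<Rightarrow> 'a set \<Rightarrow> bool" where
  "set_nbhd X K N \<longleftrightarrow> N \<subseteq> topspace X \<and> K \<subseteq> X interior_of N"

definition set_nbhd_base :: "'a topology \<Rightarrow> 'a set \<Rightarrow> 'a set set \<Rightarrow> bool" where
  "set_nbhd_base X K \<B> \<longleftrightarrow>
     (\<forall>N\<in>\<B>. set_nbhd X K N) \<and> (\<forall>N. set_nbhd X K N \<longrightarrow> (\<exists>A\<in>\<B>. A \<subseteq> N))"

end

theory Submission
  imports Defs
begin

text \<open>
  Let \<open>R\<^bsub>U\<^esub>\<close> be the relation of being joined by a \<open>U\<close>-chain, so that \<open>\<C>f\<close> is the intersection
  of all \<open>R\<^bsub>U\<^esub>\<close>.  For every \<open>U\<close> there is a \<open>W\<close> with \<open>W \<circ> R\<^bsub>W\<^esub> \<circ> W \<subseteq> R\<^bsub>U\<^esub>\<close>, so cluster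
  points of the \<open>R\<^bsub>W\<^esub>\<close> lie in \<open>\<C>f\<close>; hence \<open>\<C>f\<close> is closed, and compactness shows that each
  \<open>\<C>f\<close>-step has a first and a last \<open>f\<close>-step and that the open inward sets \<open>U(K) \<union> R\<^bsub>U\<^esub>(K)\<close>
  shrink to \<open>K\<close> if \<open>K\<close> is closed and \<open>\<C>f\<close> \<open>\<^sup>+\<close>invariant.  In a closed \<open>\<C>f\<close> invariant set
  every point has an infinite backward \<open>\<C>f\<close>-orbit, whose cluster points are chain recurrent, so
  such a set is determined by its trace.
\<close>

section \<open>Neighborhoods of the diagonal\<close>

lemma diag_nbhd_subset: "diag_nbhd X U \<Longrightarrow> U \<subseteq> topspace X \<times> topspace X"
  by (simp add: diag_nbhd_def)

lemma diag_nbhd_openin: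
  "openin (prod_topology X X) U \<Longrightarrow> Id_on (topspace X) \<subseteq> U \<Longrightarrow> diag_nbhd X U"
  using openin_subset[of "prod_topology X X" U] by (simp add: diag_nbhd_def interior_of_openin)

lemma diag_nbhd_interior:
  assumes "diag_nbhd X U"
  obtains V where "diag_nbhd X V" "openin (prod_topology X X) V" "V \<subseteq> U"
  using assms diag_nbhd_openin[OF openin_interior_of] interior_of_subset openin_interior_of
  unfolding diag_nbhd_def by metis

lemma diag_nbhd_refl: "diag_nbhd X U \<Longrightarrow> x \<in> topspace X \<Longrightarrow> (x, x) \<in> U"
  using interior_of_subset[of "prod_topology X X" U] by (fastforce simp: diag_nbhd_def)

lemma diag_nbhd_top: "diag_nbhd X (topspace X \<times> topspace X)"
  by (intro diag_nbhd_openin) (auto simp: openin_prod_Times_iff)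

lemma diag_nbhd_Int: "diag_nbhd X U \<Longrightarrow> diag_nbhd X V \<Longrightarrow> diag_nbhd X (U \<inter> V)"
  unfolding diag_nbhd_def by (auto simp: interior_of_Int)

text \<open>A common lower bound is asked for rather than the intersection itself: the intersection
  of the empty family is \<open>UNIV\<close>, which need not lie in the square of the space.\<close>

lemma diag_nbhd_finite_Inter:
  assumes "finite \<U>" "\<And>U. U \<in> \<U> \<Longrightarrow> diag_nbhd X U"
  obtains V where "diag_nbhd X V" "\<And>U. U \<in> \<U> \<Longrightarrow> V \<subseteq> U"
  using assms
proof (induction \<U> arbitrary: thesis rule: finite_induct)
  case empty
  then show ?case using diag_nbhd_top by blast
next
  case (insert U \<U>)
  obtain V where "diag_nbhd X V" "\<And>U. U \<in> \<U> \<Longrightarrow> V \<subseteq> U"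
    using insert.IH insert.prems(2) by (metis insertCI)
  then show ?case
    using insert.prems(1)[of "U \<inter> V"] insert.prems(2)[of U] diag_nbhd_Int[of X U V] by blast
qed

section \<open>Images and sections of open and closed relations\<close>

lemma openin_Image_singleton:
  assumes "openin (prod_topology X Y) U"
  shows "openin Y (U `` {x})"
proof (cases "x \<in> topspace X")
  case True
  then have "continuous_map Y (prod_topology X Y) (\<lambda>y. (x, y))"
    by (simp add: continuous_map_pairedI)
  from openin_continuous_map_preimage[OF this assms]
  have "openin Y {y \<in> topspace Y. (x, y) \<in> U}" .
  moreover have "{y \<in> topspace Y. (x, y) \<in> U} = U `` {x}"
    using openin_subset[OF assms] by auto
  ultimately show ?thesis by simp
next
  case False
  then have "U `` {x} = {}"
    using openin_subset[OF assms] by auto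
  then show ?thesis by simp
qed

lemma openin_Image:
  assumes "openin (prod_topology X Y) U"
  shows "openin Y (U `` Z)"
proof -
  have "openin Y (\<Union>x\<in>Z. U `` {x})"
    using openin_Image_singleton[OF assms] by (intro openin_Union) auto
  moreover have "(\<Union>x\<in>Z. U `` {x}) = U `` Z"
    by auto
  ultimately show ?thesis by simp
qed

lemma openin_converse:
  assumes "openin (prod_topology X Y) U"
  shows "openin (prod_topology Y X) (U\<inverse>)"
proof -
  have "openin (prod_topology Y X) {q \<in> topspace (prod_topology Y X). prod.swap q \<in> U}"
    using assms by (intro openin_continuous_map_preimage[of _ "prod_topology X Y"])
      (auto simp: prod.swap_def intro!: continuous_map_pairedI continuous_map_fst continuous_map_snd)
  moreover have "{q \<in> topspace (prod_topology Y X). prod.swap q \<in> U} = U\<inverse>"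
    using openin_subset[OF assms] by auto
  ultimately show ?thesis by simp
qed

text \<open>The image is the projection of a closed set along the compact factor, and such
  projections are closed maps.\<close>

lemma closedin_Image:
  assumes "compact_space X" "closedin (prod_topology X Y) r" "closedin X D"
  shows "closedin Y (r `` D)"
proof -
  have "r `` D = snd ` (r \<inter> D \<times> topspace Y)"
    using closedin_subset[OF assms(2)] by force
  moreover have "closedin (prod_topology X Y) (r \<inter> D \<times> topspace Y)"
    using assms by (simp add: closedin_Int closedin_prod_Times_iff)
  ultimately show ?thesis
    using closed_map_snd[OF assms(1), of Y] by (simp add: closed_map_def)
qed

lemma closedin_converse_Image_singleton:
  assumes "closedin (prod_topology X Y) r" "y \<in> topspace Y"
  shows "closedin X {x. (x, y) \<in> r}"
proof -
  have "continuous_map X (prod_topology X Y) (\<lambda>x. (x, y))"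
    using assms(2) by (simp add: continuous_map_pairedI)
  from closedin_continuous_map_preimage[OF this assms(1)]
  have "closedin X {x \<in> topspace X. (x, y) \<in> r}" .
  moreover have "{x \<in> topspace X. (x, y) \<in> r} = {x. (x, y) \<in> r}"
    using closedin_subset[OF assms(1)] by auto
  ultimately show ?thesis by simp
qed

text \<open>The family \<open>S\<close> is directed downwards, so compactness yields a common cluster point in \<open>T\<close>.\<close>

lemma diag_nbhd_cluster_point:
  assumes "compact_space Y" "closedin Y T"
    and mono: "\<And>U V. diag_nbhd X U \<Longrightarrow> diag_nbhd X V \<Longrightarrow> U \<subseteq> V \<Longrightarrow> S U \<subseteq> S V"
    and meets: "\<And>U. diag_nbhd X U \<Longrightarrow> S U \<inter> T \<noteq> {}"
  obtains p where "p \<in> T"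
    "\<And>U N. diag_nbhd X U \<Longrightarrow> openin Y N \<Longrightarrow> p \<in> N \<Longrightarrow> N \<inter> S U \<noteq> {}"
proof -
  \<comment> \<open>The sets \<open>S U\<close> need not be closed, so the finite intersection
    property is applied to closures.\<close>
  let ?C = "\<lambda>U. Y closure_of (S U \<inter> T)"
  have "\<Inter>(?C ` Collect (diag_nbhd X)) \<noteq> {}"
  proof (rule assms(1)[unfolded compact_space_fip, rule_format], intro conjI allI impI ballI)
    fix \<F> assume "finite \<F> \<and> \<F> \<subseteq> ?C ` Collect (diag_nbhd X)"
    then obtain \<U> where \<U>: "finite \<U>" "\<U> \<subseteq> Collect (diag_nbhd X)" "\<F> = ?C ` \<U>"
      by (metis finite_subset_image)
    obtain V where V: "diag_nbhd X V" "\<And>U. U \<in> \<U> \<Longrightarrow> V \<subseteq> U"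
      using diag_nbhd_finite_Inter[OF \<U>(1)] \<U>(2) by blast
    obtain q where q: "q \<in> S V" "q \<in> T"
      using meets[OF V(1)] by blast
    have "q \<in> ?C U" if "U \<in> \<U>" for U
    proof -
      have "q \<in> S U \<inter> T"
        using mono[of V U] V \<U>(2) that q by blast
      then show ?thesis
        using closedin_subset[OF assms(2)] closure_of_subset_Int[of Y "S U \<inter> T"] by blast
    qed
    then show "\<Inter>\<F> \<noteq> {}" using \<U>(3) by blast
  qed auto
  then obtain p where p: "\<And>U. diag_nbhd X U \<Longrightarrow> p \<in> ?C U"
    by blast
  \<comment> \<open>Each of these closures lies in the closed set \<open>T\<close>; the largest
    neighborhood of the diagonal supplies one of them.\<close>
  have "p \<in> T"
    using p[OF diag_nbhd_top] closure_of_minimal[of "S _ \<inter> T" T Y] assms(2) by blast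
  moreover have "N \<inter> S U \<noteq> {}" if "diag_nbhd X U" "openin Y N" "p \<in> N" for U N
    using p[OF that(1)] that by (auto simp: in_closure_of)
  ultimately show thesis using that by blast
qed

section \<open>Separation and halving in the uniformity of a compact Hausdorff space\<close>

text \<open>\<open>W\<close> is built so that a \<open>W\<close>-step starting in \<open>P\<close>
  ends in \<open>P'\<close> and a \<open>W\<close>-step ending in \<open>Q\<close> starts in
  \<open>Q'\<close>. The midpoint of a double step from \<open>P\<close> to \<open>Q\<close> would
  lie in both of the disjoint sets \<open>P'\<close> and \<open>Q'\<close>.\<close>

lemma diag_nbhd_separating:
  assumes "regular_space X" "Hausdorff_space X" "x \<in> topspace X" "z \<in> topspace X" "x \<noteq> z"
  obtains W P Q where "diag_nbhd X W" "openin X P" "openin X Q" "x \<in> P" "z \<in> Q"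
    "(W O W) \<inter> P \<times> Q = {}"
proof -
  obtain P' Q' where PQ': "openin X P'" "openin X Q'" "x \<in> P'" "z \<in> Q'" "disjnt P' Q'"
    using assms(2-5) unfolding Hausdorff_space_def by metis
  have shrink: "\<exists>S. openin X S \<and> s \<in> S \<and> X closure_of S \<subseteq> S'" if "openin X S'" "s \<in> S'" for s S'
  proof -
    have "closedin X (topspace X - S') \<and> s \<in> topspace X - (topspace X - S')"
      using that openin_subset[OF that(1)] by auto
    then obtain S where S: "openin X S" "s \<in> S" "disjnt (topspace X - S') (X closure_of S)"
      using assms(1) unfolding regular_space by meson
    then show ?thesis
      using closure_of_subset_topspace[of X S] by (intro exI[of _ S]) (auto simp: disjnt_iff)
  qed
  obtain P where P: "openin X P" "x \<in> P" "X closure_of P \<subseteq> P'"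
    using shrink PQ' by meson
  obtain Q where Q: "openin X Q" "z \<in> Q" "X closure_of Q \<subseteq> Q'"
    using shrink PQ' by meson
  define W where "W = (topspace X \<times> topspace X) -
      ((X closure_of P) \<times> (topspace X - P') \<union> (topspace X - Q') \<times> (X closure_of Q))"
  have "diag_nbhd X W"
  proof (rule diag_nbhd_openin)
    have "closedin (prod_topology X X)
        ((X closure_of P) \<times> (topspace X - P') \<union> (topspace X - Q') \<times> (X closure_of Q))"
      using PQ' by (intro closedin_Un) (auto simp: closedin_prod_Times_iff)
    then show "openin (prod_topology X X) W"
      unfolding W_def by (metis openin_diff openin_topspace topspace_prod_topology)
    show "Id_on (topspace X) \<subseteq> W"
      using P(3) Q(3) by (auto simp: W_def)
  qed
  moreover have "(W O W) \<inter> P \<times> Q = {}"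
  proof -
    have "P \<subseteq> X closure_of P" "Q \<subseteq> X closure_of Q"
      using P(1) Q(1) by (simp_all add: closure_of_subset openin_subset)
    then show ?thesis using PQ'(5) by (auto simp: W_def disjnt_iff)
  qed
  ultimately show thesis using that P Q by blast
qed

text \<open>If every \<open>W O W\<close> met the complement of the open set \<open>V'\<close>,
  these relations would cluster at a pair outside \<open>V'\<close>, hence off the diagonal. The two
  points of that pair can be separated, which rules the cluster point out.\<close>

lemma diag_nbhd_halving:
  assumes "compact_space X" "Hausdorff_space X" "diag_nbhd X V"
  obtains W where "diag_nbhd X W" "W \<subseteq> V" "W O W \<subseteq> V"
proof -
  obtain V' where V': "diag_nbhd X V'" "openin (prod_topology X X) V'" "V' \<subseteq> V"
    using diag_nbhd_interior assms(3) by blast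
  let ?T = "topspace X \<times> topspace X - V'"
  have cl: "closedin (prod_topology X X) ?T"
    using V'(2) by (metis closedin_diff closedin_topspace topspace_prod_topology)
  have reg: "regular_space X"
    using assms by (simp add: compact_Hausdorff_imp_regular_space)
  have "\<exists>W. diag_nbhd X W \<and> (W O W) \<inter> ?T = {}"
  proof (rule ccontr)
    assume "\<nexists>W. diag_nbhd X W \<and> (W O W) \<inter> ?T = {}"
    then have meets: "(W O W) \<inter> ?T \<noteq> {}" if "diag_nbhd X W" for W
      using that by blast
    have comp: "compact_space (prod_topology X X)"
      using assms(1) by (simp add: compact_space_prod_topology)
    obtain p where p: "p \<in> ?T" "\<And>U N. diag_nbhd X U \<Longrightarrow> openin (prod_topology X X) N \<Longrightarrow>
        p \<in> N \<Longrightarrow> N \<inter> (U O U) \<noteq> {}"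
      using diag_nbhd_cluster_point[OF comp cl, of X "\<lambda>U. U O U"] meets
      by (metis relcomp_mono)
    obtain x z where xz: "p = (x, z)" "x \<in> topspace X" "z \<in> topspace X" "(x, z) \<notin> V'"
      using p(1) by auto
    then have "x \<noteq> z"
      using diag_nbhd_refl[OF V'(1)] by auto
    obtain W P Q where W: "diag_nbhd X W" "openin X P" "openin X Q" "x \<in> P" "z \<in> Q"
      "(W O W) \<inter> P \<times> Q = {}"
      using diag_nbhd_separating[OF reg assms(2) xz(2,3) \<open>x \<noteq> z\<close>] by blast
    show False
      using p(2)[OF W(1), of "P \<times> Q"] W xz by (auto simp: openin_prod_Times_iff)
  qed
  then obtain W where W: "diag_nbhd X W" "(W O W) \<inter> ?T = {}" by blast
  have "W O W \<subseteq> V'"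
    using W diag_nbhd_subset[OF W(1)] by blast
  \<comment> \<open>\<open>W\<close> contains the diagonal and so is contained in
    \<open>W O W\<close>.\<close>
  then have "W O W \<subseteq> V" "W \<subseteq> V"
    using V'(3) diag_nbhd_refl[OF W(1)] diag_nbhd_subset[OF W(1)] by blast+
  then show thesis using that W(1) by blast
qed

section \<open>Chains with errors in a fixed neighborhood\<close>

text \<open>The relation \<open>R\<^bsub>U\<^esub>\<close> above; \<open>O\<close> composes from left to right, unlike the paper's \<open>\<circ>\<close>.\<close>

definition chain_rel :: "('a \<times> 'a) set \<Rightarrow> ('a \<times> 'a) set \<Rightarrow> ('a \<times> 'a) set" where
  "chain_rel f U = (U O f)\<^sup>+ O U"

text \<open>This trades the indexed chains in the definition of \<open>conley\<close> for a
  transitive closure, on which composition can be computed algebraically.\<close>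

lemma chain_rel_iff:
  "(x, y) \<in> chain_rel f U \<longleftrightarrow>
     (\<exists>(n::nat) a b. n \<ge> 1 \<and> (\<forall>i\<in>{1..n}. (a i, b i) \<in> f) \<and>
        (x, a 1) \<in> U \<and> (\<forall>i\<in>{1..<n}. (b i, a (Suc i)) \<in> U) \<and> (b n, y) \<in> U)" (is "_ \<longleftrightarrow> ?R")
proof
  assume "(x, y) \<in> chain_rel f U"
  then obtain n g where n: "n > 0" "g 0 = x" "(g n, y) \<in> U" "\<forall>i<n. (g i, g (Suc i)) \<in> U O f"
    unfolding chain_rel_def by (auto simp: trancl_power relpow_fun_conv)
  then have "\<forall>i<n. \<exists>c. (g i, c) \<in> U \<and> (c, g (Suc i)) \<in> f" by blast
  then obtain c where c: "\<And>i. i < n \<Longrightarrow> (g i, c i) \<in> U \<and> (c i, g (Suc i)) \<in> f" by metis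
  \<comment> \<open>Chains count their \<open>f\<close>-steps from 1, relation powers count from 0;
    hence the shift. The endpoints of the \<open>f\<close>-steps are the values of \<open>g\<close>
    itself.\<close>
  let ?a = "\<lambda>i. c (i - 1)"
  have "(?a i, g i) \<in> f" if "i \<in> {1..n}" for i
    using c[of "i - 1"] that by auto
  moreover have "(x, ?a 1) \<in> U"
    using c[of 0] n by simp
  moreover have "(g i, ?a (Suc i)) \<in> U" if "i \<in> {1..<n}" for i
    using c[of i] that by simp
  ultimately show ?R using n by (intro exI[of _ n] exI[of _ ?a] exI[of _ g]) auto
next
  assume ?R
  then obtain n a b where n: "n \<ge> 1" and f: "\<And>i. i \<in> {1..n} \<Longrightarrow> (a i, b i) \<in> f"
    and U: "(x, a 1) \<in> U" "\<And>i. i \<in> {1..<n} \<Longrightarrow> (b i, a (Suc i)) \<in> U" "(b n, y) \<in> U"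
    by blast
  \<comment> \<open>The value \<open>b 0\<close> is unconstrained, so it is replaced by the start of
    the chain.\<close>
  let ?g = "\<lambda>i. if i = 0 then x else b i"
  have "(?g i, ?g (Suc i)) \<in> U O f" if "i < n" for i
    using f[of "Suc i"] U(1) U(2)[of i] that by (cases "i = 0") auto
  then have "(x, b n) \<in> (U O f) ^^ n"
    unfolding relpow_fun_conv using n by (intro exI[of _ ?g]) auto
  then have "(x, b n) \<in> (U O f)\<^sup>+"
    using n unfolding trancl_power by (intro exI[of _ n]) auto
  then show "(x, y) \<in> chain_rel f U"
    unfolding chain_rel_def using U(3) by blast
qed

lemma conley_iff:
  "(x, y) \<in> conley X f \<longleftrightarrow> x \<in> topspace X \<and> y \<in> topspace X \<and>
     (\<forall>U. diag_nbhd X U \<longrightarrow> (x, y) \<in> chain_rel f U)"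
  unfolding conley_def chain_rel_iff by blast

lemma chain_rel_mono: "U \<subseteq> V \<Longrightarrow> chain_rel f U \<subseteq> chain_rel f V"
  unfolding chain_rel_def by (intro relcomp_mono trancl_mono_subset) auto

text \<open>What precedes the last \<open>f\<close>-step is only an error in \<open>U\<close> if the
  chain has a single \<open>f\<close>-step; hence the union with \<open>U\<close>.\<close>

lemma chain_rel_last:
  assumes "(x, y) \<in> chain_rel f U"
  obtains a b where "(x, a) \<in> U \<union> chain_rel f U" "(a, b) \<in> f" "(b, y) \<in> U"
proof -
  have "chain_rel f U = (U \<union> chain_rel f U) O f O U"
    unfolding chain_rel_def
    by (subst (1) trancl_unfold) (auto 4 4)
  then show thesis using assms that by blast
qed

lemma chain_rel_first:
  assumes "(x, y) \<in> chain_rel f U"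
  obtains a b where "(x, a) \<in> U" "(a, b) \<in> f" "(b, y) \<in> U \<union> chain_rel f U"
proof -
  obtain z where z: "(x, z) \<in> (U O f)\<^sup>+" "(z, y) \<in> U"
    using assms unfolding chain_rel_def by blast
  from tranclD[OF z(1)] obtain b where b: "(x, b) \<in> U O f" "(b, z) \<in> (U O f)\<^sup>*"
    by blast
  have "(b, y) \<in> U \<union> chain_rel f U"
    using b(2) z(2) unfolding chain_rel_def by (auto simp: rtrancl_eq_or_trancl)
  then show thesis using b(1) that by blast
qed

lemma chain_rel_extend:
  "(x, y) \<in> U \<union> chain_rel f U \<Longrightarrow> (y, z) \<in> f \<Longrightarrow> (z, w) \<in> U \<Longrightarrow> (x, w) \<in> chain_rel f U"
  unfolding chain_rel_def by (auto intro: relcompI trancl_into_trancl)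

text \<open>Gluing creates just one pair of adjacent errors, at the start, at the end or in the
  middle. The first assumption merges it into one error in \<open>V\<close>; the second enlarges the
  remaining errors.\<close>

lemma chain_rel_comp:
  assumes "U O U \<subseteq> V" "U \<subseteq> V"
  shows "U O chain_rel f U \<subseteq> chain_rel f V" "chain_rel f U O U \<subseteq> chain_rel f V"
    "chain_rel f U O chain_rel f U \<subseteq> chain_rel f V"
proof -
  have t: "(U O f)\<^sup>+ \<subseteq> (V O f)\<^sup>+"
    using assms(2) by (intro trancl_mono_subset) auto
  have l: "U O (U O f)\<^sup>+ \<subseteq> (V O f)\<^sup>+"
  proof
    fix p assume "p \<in> U O (U O f)\<^sup>+"
    then obtain x u z where p: "p = (x, z)" "(x, u) \<in> U" "(u, z) \<in> (U O f)\<^sup>+" by auto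
    from tranclD[OF p(3)] obtain v where v: "(u, v) \<in> U O f" "(v, z) \<in> (U O f)\<^sup>*" by blast
    have "(x, v) \<in> V O f" using p(2) v(1) assms(1) by blast
    moreover have "(v, z) \<in> (V O f)\<^sup>*"
      using v(2) rtrancl_mono[of "U O f" "V O f"] assms(2) by blast
    ultimately show "p \<in> (V O f)\<^sup>+" using p(1) by (meson rtrancl_into_trancl2)
  qed
  show "U O chain_rel f U \<subseteq> chain_rel f V"
    unfolding chain_rel_def O_assoc[symmetric] using l assms(2) by (intro relcomp_mono)
  show "chain_rel f U O U \<subseteq> chain_rel f V"
    unfolding chain_rel_def O_assoc using t assms(1) by (intro relcomp_mono)
  have "chain_rel f U O chain_rel f U = (U O f)\<^sup>+ O (U O (U O f)\<^sup>+) O U"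
    unfolding chain_rel_def by (simp add: O_assoc)
  also have "\<dots> \<subseteq> (V O f)\<^sup>+ O (V O f)\<^sup>+ O V"
    using t l assms(2) by (intro relcomp_mono)
  also have "\<dots> \<subseteq> chain_rel f V"
    unfolding chain_rel_def by (auto intro: trancl_trans)
  finally show "chain_rel f U O chain_rel f U \<subseteq> chain_rel f V" .
qed

section \<open>Families of relations that absorb small errors\<close>

text \<open>This abstracts what the identity family, \<open>chain_rel f\<close> and their union
  share. Absorbing errors at both ends stands in for closedness of the single relations.\<close>

definition absorbing :: "'a topology \<Rightarrow> (('a \<times> 'a) set \<Rightarrow> ('a \<times> 'a) set) \<Rightarrow> bool" where
  "absorbing X S \<longleftrightarrow> (\<forall>U V. U \<subseteq> V \<longrightarrow> S U \<subseteq> S V) \<and>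
     (\<forall>V. diag_nbhd X V \<longrightarrow> (\<exists>W. diag_nbhd X W \<and> W O S W O W \<subseteq> S V))"

lemma absorbing_mono: "absorbing X S \<Longrightarrow> U \<subseteq> V \<Longrightarrow> S U \<subseteq> S V"
  by (simp add: absorbing_def)

text \<open>A box around \<open>(x, y)\<close> made of \<open>W\<close>-close points meets
  \<open>S W\<close> in some \<open>(c, d)\<close>. Going from \<open>x\<close> to \<open>c\<close>,
  on to \<open>d\<close> and then to \<open>y\<close> is a path in
  \<open>W O S W O W\<close>.\<close>

lemma absorbing_cluster:
  assumes "absorbing X S" "x \<in> topspace X" "y \<in> topspace X" "diag_nbhd X V"
    and near: "\<And>U N. diag_nbhd X U \<Longrightarrow> openin (prod_topology X X) N \<Longrightarrow> (x, y) \<in> N \<Longrightarrow>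
      N \<inter> S U \<noteq> {}"
  shows "(x, y) \<in> S V"
proof -
  obtain W where W: "diag_nbhd X W" "W O S W O W \<subseteq> S V"
    using assms(1,4) unfolding absorbing_def by blast
  obtain W' where W': "diag_nbhd X W'" "openin (prod_topology X X) W'" "W' \<subseteq> W"
    using diag_nbhd_interior[OF W(1)] by blast
  let ?N = "(W' `` {x}) \<times> (W'\<inverse> `` {y})"
  have "openin (prod_topology X X) ?N"
    using W'(2) by (simp add: openin_prod_Times_iff openin_Image openin_Image[OF openin_converse])
  moreover have "(x, y) \<in> ?N"
    using diag_nbhd_refl[OF W'(1)] assms(2,3) by blast
  ultimately obtain c d where "(c, d) \<in> ?N" "(c, d) \<in> S W"
    using near[OF W(1)] by blast
  then have "(x, c) \<in> W" "(c, d) \<in> S W" "(d, y) \<in> W"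
    using W'(3) by blast+
  then show ?thesis
    using W(2) by blast
qed

section \<open>Closedness and transitivity of the Conley relation\<close>

locale compact_relation =
  fixes X :: "'a topology" and f :: "('a \<times> 'a) set"
  assumes compact: "compact_space X" and Hausdorff: "Hausdorff_space X"
    and closed: "closedin (prod_topology X X) f"
begin

lemma f_subset: "f \<subseteq> topspace X \<times> topspace X"
  using closedin_subset[OF closed] by simp

lemma conley_subset: "conley X f \<subseteq> topspace X \<times> topspace X"
  by (auto simp: conley_def)

lemma compact_prod: "compact_space (prod_topology X X)"
  using compact by (simp add: compact_space_prod_topology)

lemma halving3:
  assumes "diag_nbhd X V"
  obtains U W where "diag_nbhd X W" "W \<subseteq> U" "W O W \<subseteq> U" "U \<subseteq> V" "U O U \<subseteq> V"
  using diag_nbhd_halving[OF compact Hausdorff] assms by metis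

lemma absorbing_id: "absorbing X (\<lambda>U. U)"
  unfolding absorbing_def
proof (intro conjI allI impI)
  fix V assume "diag_nbhd X V"
  then obtain U W where UW: "diag_nbhd X W" "W \<subseteq> U" "W O W \<subseteq> U" "U \<subseteq> V" "U O U \<subseteq> V"
    by (rule halving3)
  have "W O W O W \<subseteq> U O U"
    using UW(2,3) by (intro relcomp_mono)
  then show "\<exists>W. diag_nbhd X W \<and> W O W O W \<subseteq> V"
    using UW(1,5) by blast
qed

lemma absorbing_chain_rel: "absorbing X (chain_rel f)"
  unfolding absorbing_def
proof (intro conjI allI impI)
  fix V assume "diag_nbhd X V"
  then obtain U W where UW: "diag_nbhd X W" "W \<subseteq> U" "W O W \<subseteq> U" "U \<subseteq> V" "U O U \<subseteq> V"
    by (rule halving3)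
  have "W O chain_rel f W O W \<subseteq> U O chain_rel f U"
    using UW(2) chain_rel_comp(2)[OF UW(3,2)] by (intro relcomp_mono)
  also have "\<dots> \<subseteq> chain_rel f V"
    using chain_rel_comp(1)[OF UW(5,4)] .
  finally show "\<exists>W. diag_nbhd X W \<and> W O chain_rel f W O W \<subseteq> chain_rel f V"
    using UW(1) by blast
qed (rule chain_rel_mono)

lemma absorbing_Un:
  assumes "absorbing X S" "absorbing X S'"
  shows "absorbing X (\<lambda>U. S U \<union> S' U)"
  unfolding absorbing_def
proof (intro conjI allI impI)
  fix V assume "diag_nbhd X V"
  then obtain W W' where W: "diag_nbhd X W" "W O S W O W \<subseteq> S V"
    and W': "diag_nbhd X W'" "W' O S' W' O W' \<subseteq> S' V"
    using assms unfolding absorbing_def by metis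
  have "S (W \<inter> W') \<subseteq> S W" "S' (W \<inter> W') \<subseteq> S' W'"
    using assms by (auto dest: absorbing_mono[of X S "W \<inter> W'" W] absorbing_mono[of X S' "W \<inter> W'" W'])
  then have "(W \<inter> W') O (S (W \<inter> W') \<union> S' (W \<inter> W')) O (W \<inter> W') \<subseteq> S V \<union> S' V"
    using W(2) W'(2) by blast
  then show "\<exists>W. diag_nbhd X W \<and> W O (S W \<union> S' W) O W \<subseteq> S V \<union> S' V"
    using diag_nbhd_Int[OF W(1) W'(1)] by blast
next
  fix U V :: "('a \<times> 'a) set" assume "U \<subseteq> V"
  then show "S U \<union> S' U \<subseteq> S V \<union> S' V"
    using assms absorbing_mono by (metis Un_mono)
qed

lemmas absorbing_reach = absorbing_Un[OF absorbing_id absorbing_chain_rel]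

lemma eq_if_diag_nbhd:
  assumes "x \<in> topspace X" "y \<in> topspace X" "\<And>U. diag_nbhd X U \<Longrightarrow> (x, y) \<in> U"
  shows "x = y"
proof (rule ccontr)
  assume "x \<noteq> y"
  moreover have "regular_space X"
    using compact Hausdorff by (simp add: compact_Hausdorff_imp_regular_space)
  ultimately obtain W P Q where W: "diag_nbhd X W" "x \<in> P" "y \<in> Q" "(W O W) \<inter> P \<times> Q = {}"
    using diag_nbhd_separating Hausdorff assms(1,2) by metis
  then show False
    using diag_nbhd_refl[OF W(1) assms(1)] assms(3)[OF W(1)] by blast
qed

text \<open>The alternative can be chosen independently of \<open>U\<close>: if one neighborhood
  refuted closeness and another refuted chains, their intersection would refute both.\<close>

lemma eq_or_conley:
  assumes "x \<in> topspace X" "y \<in> topspace X"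
    and reach: "\<And>U. diag_nbhd X U \<Longrightarrow> (x, y) \<in> U \<union> chain_rel f U"
  shows "x = y \<or> (x, y) \<in> conley X f"
proof (rule ccontr)
  assume *: "\<not> ?thesis"
  then obtain U where U: "diag_nbhd X U" "(x, y) \<notin> chain_rel f U"
    using assms(1,2) unfolding conley_iff by blast
  obtain V where V: "diag_nbhd X V" "(x, y) \<notin> V"
    using * eq_if_diag_nbhd[OF assms(1,2)] by blast
  show False
    using reach[OF diag_nbhd_Int[OF U(1) V(1)]] U(2) V(2) chain_rel_mono[of "U \<inter> V" U f] by blast
qed

text \<open>Near a point of the closure there are pairs of \<open>conley X f\<close>, and these lie
  in every \<open>chain_rel f U\<close>. Absorption then puts the point itself into every
  \<open>chain_rel f V\<close>.\<close>

lemma conley_closed: "closedin (prod_topology X X) (conley X f)"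
proof -
  have "prod_topology X X closure_of conley X f \<subseteq> conley X f"
  proof
    fix p assume p: "p \<in> prod_topology X X closure_of conley X f"
    then obtain x y where xy: "p = (x, y)" "x \<in> topspace X" "y \<in> topspace X"
      by (auto simp: in_closure_of)
    have "(x, y) \<in> chain_rel f V" if "diag_nbhd X V" for V
      using absorbing_chain_rel xy(2,3) that
    proof (rule absorbing_cluster)
      fix U N assume UN: "diag_nbhd X U" "openin (prod_topology X X) N" "(x, y) \<in> N"
      then obtain q where "q \<in> conley X f" "q \<in> N"
        using p xy(1) by (auto simp: in_closure_of)
      then show "N \<inter> chain_rel f U \<noteq> {}"
        using UN(1) by (cases q) (auto simp: conley_iff)
    qed
    then show "p \<in> conley X f"
      using xy by (simp add: conley_iff)
  qed
  then show ?thesis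
    using conley_subset by (simp add: closure_of_subset_eq[symmetric])
qed

lemma trans_conley: "trans (conley X f)"
proof (rule transI)
  fix x y z assume xyz: "(x, y) \<in> conley X f" "(y, z) \<in> conley X f"
  have "(x, z) \<in> chain_rel f V" if "diag_nbhd X V" for V
  proof -
    obtain W where W: "diag_nbhd X W" "W \<subseteq> V" "W O W \<subseteq> V"
      using diag_nbhd_halving[OF compact Hausdorff \<open>diag_nbhd X V\<close>] by blast
    have "(x, z) \<in> chain_rel f W O chain_rel f W"
      using xyz W(1) by (auto simp: conley_iff)
    then show ?thesis
      using chain_rel_comp(3)[OF W(3,2)] by blast
  qed
  then show "(x, z) \<in> conley X f"
    using xyz by (simp add: conley_iff)
qed

lemma f_subset_conley: "f \<subseteq> conley X f"
proof (rule subrelI)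
  fix x y assume xy: "(x, y) \<in> f"
  then have X: "x \<in> topspace X" "y \<in> topspace X"
    using f_subset by auto
  have "(x, y) \<in> chain_rel f U" if "diag_nbhd X U" for U
    using chain_rel_extend[OF _ xy, of x U y] diag_nbhd_refl[OF that] X by blast
  then show "(x, y) \<in> conley X f"
    using X by (simp add: conley_iff)
qed

section \<open>Exact first and last steps of a Conley chain\<close>

text \<open>The intermediate \<open>f\<close>-step may vary with \<open>U\<close>. Since
  \<open>f\<close> is closed in a compact product, these steps cluster at a single pair of
  \<open>f\<close>, which works for all \<open>U\<close> by absorption.\<close>

lemma absorbing_factor:
  assumes S: "absorbing X S" and T: "absorbing X T" and X: "x \<in> topspace X" "y \<in> topspace X"
    and factor: "\<And>U. diag_nbhd X U \<Longrightarrow> \<exists>(a, b)\<in>f. (x, a) \<in> S U \<and> (b, y) \<in> T U"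
  obtains a b where "(a, b) \<in> f" "\<And>U. diag_nbhd X U \<Longrightarrow> (x, a) \<in> S U"
    "\<And>U. diag_nbhd X U \<Longrightarrow> (b, y) \<in> T U"
proof -
  let ?S = "\<lambda>U. {(a, b). (x, a) \<in> S U \<and> (b, y) \<in> T U}"
  obtain p where p: "p \<in> f" "\<And>U N. diag_nbhd X U \<Longrightarrow> openin (prod_topology X X) N \<Longrightarrow>
      p \<in> N \<Longrightarrow> N \<inter> ?S U \<noteq> {}"
  proof (rule diag_nbhd_cluster_point[OF compact_prod closed, of X ?S])
    fix U V :: "('a \<times> 'a) set" assume "U \<subseteq> V"
    then show "?S U \<subseteq> ?S V"
      using absorbing_mono[OF S, of U V] absorbing_mono[OF T, of U V] by auto
  next
    fix U assume "diag_nbhd X U"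
    from factor[OF this] show "?S U \<inter> f \<noteq> {}" by blast
  next
    fix p assume "p \<in> f" and "\<And>U N. diag_nbhd X U \<Longrightarrow> openin (prod_topology X X) N \<Longrightarrow>
      p \<in> N \<Longrightarrow> N \<inter> ?S U \<noteq> {}"
    then show thesis by (rule that)
  qed
  obtain a b where ab: "p = (a, b)" "a \<in> topspace X" "b \<in> topspace X"
    using p(1) f_subset by blast
  have "(x, a) \<in> S V" if "diag_nbhd X V" for V
    using S X(1) ab(2) that
  proof (rule absorbing_cluster)
    fix U N assume UN: "diag_nbhd X U" "openin (prod_topology X X) N" "(x, a) \<in> N"
    \<comment> \<open>A strip with the whole space as other factor constrains only the first
      component of the clustering pairs.\<close>
    then have "openin (prod_topology X X) ((N `` {x}) \<times> topspace X)"
      by (simp add: openin_prod_Times_iff openin_Image)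
    then show "N \<inter> S U \<noteq> {}"
      using p(2)[OF UN(1)] UN(3) ab by blast
  qed
  moreover have "(b, y) \<in> T V" if "diag_nbhd X V" for V
    using T ab(3) X(2) that
  proof (rule absorbing_cluster)
    fix U N assume UN: "diag_nbhd X U" "openin (prod_topology X X) N" "(b, y) \<in> N"
    then have "openin (prod_topology X X) (topspace X \<times> (N\<inverse> `` {y}))"
      by (simp add: openin_prod_Times_iff openin_Image openin_Image[OF openin_converse])
    then show "N \<inter> T U \<noteq> {}"
      using p(2)[OF UN(1)] UN(3) ab by blast
  qed
  ultimately show thesis
    using that p(1) ab(1) by blast
qed

text \<open>In the limit the error after the last \<open>f\<close>-step vanishes and gives
  \<open>b = y\<close>. What precedes that step becomes equality or a Conley step, according to
  \<open>eq_or_conley\<close>.\<close>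

lemma conley_last:
  assumes "(x, y) \<in> conley X f"
  obtains a where "x = a \<or> (x, a) \<in> conley X f" "(a, y) \<in> f"
proof -
  have X: "x \<in> topspace X" "y \<in> topspace X"
    using assms conley_subset by auto
  have factor: "\<exists>(a, b)\<in>f. (x, a) \<in> U \<union> chain_rel f U \<and> (b, y) \<in> U"
    if "diag_nbhd X U" for U
  proof -
    have "(x, y) \<in> chain_rel f U"
      using assms that by (simp add: conley_iff)
    then obtain a b where "(x, a) \<in> U \<union> chain_rel f U" "(a, b) \<in> f" "(b, y) \<in> U"
      by (rule chain_rel_last)
    then show ?thesis by blast
  qed
  obtain a b where ab: "(a, b) \<in> f" "\<And>U. diag_nbhd X U \<Longrightarrow> (x, a) \<in> U \<union> chain_rel f U"
    "\<And>U. diag_nbhd X U \<Longrightarrow> (b, y) \<in> U"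
    using absorbing_factor[OF absorbing_reach absorbing_id X factor] by blast
  then have "a \<in> topspace X" "b \<in> topspace X"
    using f_subset by auto
  then have "b = y" "x = a \<or> (x, a) \<in> conley X f"
    using eq_if_diag_nbhd[OF _ X(2) ab(3)] eq_or_conley[OF X(1) _ ab(2)] by auto
  then show thesis
    using that ab(1) by blast
qed

lemma conley_first:
  assumes "(x, y) \<in> conley X f"
  obtains b where "(x, b) \<in> f" "b = y \<or> (b, y) \<in> conley X f"
proof -
  have X: "x \<in> topspace X" "y \<in> topspace X"
    using assms conley_subset by auto
  have factor: "\<exists>(a, b)\<in>f. (x, a) \<in> U \<and> (b, y) \<in> U \<union> chain_rel f U"
    if "diag_nbhd X U" for U
  proof -
    have "(x, y) \<in> chain_rel f U"
      using assms that by (simp add: conley_iff)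
    then obtain a b where "(x, a) \<in> U" "(a, b) \<in> f" "(b, y) \<in> U \<union> chain_rel f U"
      by (rule chain_rel_first)
    then show ?thesis by blast
  qed
  obtain a b where ab: "(a, b) \<in> f" "\<And>U. diag_nbhd X U \<Longrightarrow> (x, a) \<in> U"
    "\<And>U. diag_nbhd X U \<Longrightarrow> (b, y) \<in> U \<union> chain_rel f U"
    using absorbing_factor[OF absorbing_id absorbing_reach X factor] by blast
  then have "a \<in> topspace X" "b \<in> topspace X"
    using f_subset by auto
  then have "x = a" "b = y \<or> (b, y) \<in> conley X f"
    using eq_if_diag_nbhd[OF X(1) _ ab(2)] eq_or_conley[OF _ X(2) ab(3)] by auto
  then show thesis
    using that ab(1) by blast
qed

lemma closedin_conley_Image: "closedin X K \<Longrightarrow> closedin X (conley X f `` K)"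
  by (rule closedin_Image[OF compact conley_closed])

lemma closedin_cyclic_set: "closedin X (cyclic_set (conley X f))"
proof -
  have "closedin X {x \<in> topspace X. (x, x) \<in> conley X f}"
    by (rule closedin_continuous_map_preimage[OF _ conley_closed]) (simp add: continuous_map_pairedI)
  moreover have "{x \<in> topspace X. (x, x) \<in> conley X f} = cyclic_set (conley X f)"
    using conley_subset by (auto simp: cyclic_set_def)
  ultimately show ?thesis by simp
qed

section \<open>Inward sets and elementary Lyapunov functions\<close>

text \<open>For an open \<open>V\<close> inside \<open>U\<close>, the \<open>V\<close>-neighborhood
  of the image of \<open>A\<close> is open and contained in \<open>A\<close>. It contains the
  closure, since the points from which \<open>x\<close> is \<open>V\<close>-close form a
  neighborhood of \<open>x\<close>.\<close>

lemma inward_closure: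
  assumes "inward X f A"
  shows "X closure_of (f `` A) \<subseteq> X interior_of A"
proof -
  obtain U where U: "diag_nbhd X U" "U `` (f `` A) \<subseteq> A"
    using assms unfolding inward_def by blast
  obtain V where V: "diag_nbhd X V" "openin (prod_topology X X) V" "V \<subseteq> U"
    using diag_nbhd_interior[OF U(1)] by blast
  have "V `` (f `` A) \<subseteq> X interior_of A"
    using U(2) V(3) openin_Image[OF V(2)] by (intro interior_of_maximal) blast+
  moreover have "X closure_of (f `` A) \<subseteq> V `` (f `` A)"
  proof
    fix x assume x: "x \<in> X closure_of (f `` A)"
    moreover have "openin X (V\<inverse> `` {x})"
      using openin_Image[OF openin_converse[OF V(2)]] .
    moreover have "x \<in> V\<inverse> `` {x}"
      using diag_nbhd_refl[OF V(1)] x by (auto simp: in_closure_of)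
    ultimately obtain y where "y \<in> f `` A" "y \<in> V\<inverse> `` {x}"
      unfolding in_closure_of by meson
    then show "x \<in> V `` (f `` A)"
      by blast
  qed
  ultimately show ?thesis by blast
qed

text \<open>An initial error could lead out of \<open>A\<close>, as \<open>A\<close> need not be
  open. So \<open>conley_first\<close> is used to begin with an exact step into the image of
  \<open>A\<close> under \<open>f\<close>; steps of \<open>U O f\<close> cannot leave that
  image.\<close>

lemma inward_conley:
  assumes "inward X f A"
  shows "conley X f `` A \<subseteq> A"
proof
  fix y assume "y \<in> conley X f `` A"
  then obtain x where x: "x \<in> A" "(x, y) \<in> conley X f" by blast
  then obtain z where z: "(x, z) \<in> f" "z = y \<or> (z, y) \<in> conley X f"
    using conley_first by blast
  obtain U where U: "diag_nbhd X U" "U `` (f `` A) \<subseteq> A"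
    using assms unfolding inward_def by blast
  have zA: "z \<in> f `` A"
    using x(1) z(1) by blast
  from z(2) show "y \<in> A"
  proof
    assume "z = y"
    moreover have "(z, z) \<in> U"
      using diag_nbhd_refl[OF U(1)] z(1) f_subset by blast
    ultimately show ?thesis using zA U(2) by blast
  next
    assume "(z, y) \<in> conley X f"
    then obtain w where w: "(z, w) \<in> (U O f)\<^sup>+" "(w, y) \<in> U"
      using U(1) unfolding conley_iff chain_rel_def by blast
    have "(U O f) `` (f `` A) \<subseteq> f `` A"
      using U(2) by blast
    then have "w \<in> f `` A"
      using w(1) zA Image_closed_trancl[of "U O f" "f `` A"] by (blast dest: trancl_into_rtrancl)
    then show ?thesis using w(2) U(2) by blast
  qed
qed

text \<open>If for every \<open>U\<close> some point outside \<open>G\<close> could be reached from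
  \<open>K\<close>, such pairs would cluster at a pair \<open>(x, y)\<close> with \<open>x\<close>
  in \<open>K\<close> and \<open>y\<close> outside \<open>G\<close>. By \<open>eq_or_conley\<close>
  and the invariance hypothesis \<open>y\<close> would lie in \<open>K\<close>.\<close>

lemma inward_nbhd:
  assumes K: "closedin X K" "conley X f `` K \<subseteq> K" and G: "openin X G" "K \<subseteq> G"
  obtains A where "openin X A" "inward X f A" "K \<subseteq> A" "A \<subseteq> G"
proof -
  have "\<exists>U. diag_nbhd X U \<and> (U \<union> chain_rel f U) \<inter> K \<times> (topspace X - G) = {}"
  proof (rule ccontr)
    let ?T = "K \<times> (topspace X - G)"
    assume "\<not> ?thesis"
    then have meets: "(U \<union> chain_rel f U) \<inter> ?T \<noteq> {}" if "diag_nbhd X U" for U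
      using that by blast
    have T: "closedin (prod_topology X X) ?T"
      using K(1) G(1) by (auto simp: closedin_prod_Times_iff)
    obtain p where p: "p \<in> ?T" "\<And>U N. diag_nbhd X U \<Longrightarrow> openin (prod_topology X X) N \<Longrightarrow>
        p \<in> N \<Longrightarrow> N \<inter> (U \<union> chain_rel f U) \<noteq> {}"
      using diag_nbhd_cluster_point[OF compact_prod T, of X "\<lambda>U. U \<union> chain_rel f U"]
        meets absorbing_mono[OF absorbing_reach] by blast
    obtain x y where xy: "p = (x, y)" "x \<in> K" "y \<in> topspace X - G"
      using p(1) by blast
    have X: "x \<in> topspace X" "y \<in> topspace X"
      using xy closedin_subset[OF K(1)] by auto
    have "(x, y) \<in> U \<union> chain_rel f U" if "diag_nbhd X U" for U
      using absorbing_cluster[OF absorbing_reach X that] p(2) xy(1) by metis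
    then have "x = y \<or> (x, y) \<in> conley X f"
      using eq_or_conley[OF X] by blast
    then show False
      using xy K(2) G(2) by blast
  qed
  then obtain U where U: "diag_nbhd X U" "(U \<union> chain_rel f U) \<inter> K \<times> (topspace X - G) = {}"
    by blast
  obtain V where V: "diag_nbhd X V" "openin (prod_topology X X) V" "V \<subseteq> U"
    using diag_nbhd_interior[OF U(1)] by blast
  \<comment> \<open>Every way of reaching a point of \<open>A\<close> ends with an error in the open
    relation \<open>V\<close>, so \<open>A\<close> is open. One more \<open>f\<close>-step and
    \<open>V\<close>-error only extends the chain, so \<open>A\<close> is inward.\<close>
  define A where "A = (V \<union> chain_rel f V) `` K"
  have "A = V `` (K \<union> (V O f)\<^sup>+ `` K)"
    unfolding A_def chain_rel_def by blast
  then have A: "openin X A"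
    using openin_Image[OF V(2)] by simp
  moreover have "K \<subseteq> A"
    using diag_nbhd_refl[OF V(1)] closedin_subset[OF K(1)] unfolding A_def by blast
  moreover have "A \<subseteq> G"
    using U(2) chain_rel_mono[OF V(3), of f] V(3) openin_subset[OF A] unfolding A_def by blast
  moreover have "V `` (f `` A) \<subseteq> A"
    using chain_rel_extend[of _ _ V f] unfolding A_def by blast
  then have "inward X f A"
    unfolding inward_def using V(1) openin_subset[OF A] by blast
  ultimately show thesis using that by blast
qed

text \<open>A Urysohn function that is 0 off \<open>A\<close> and 1 on both \<open>K\<close> and the
  closure of the image of \<open>A\<close> will do: positivity at \<open>x\<close> forces
  \<open>x\<close> into \<open>A\<close>, so its \<open>f\<close>-successors have value 1.\<close>

lemma elem_lyapunov_exists: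
  assumes K: "closedin X K" and A: "openin X A" "inward X f A" "K \<subseteq> A"
  obtains L where "elem_lyapunov X f L" "\<And>x. x \<in> topspace X - A \<Longrightarrow> L x = 0"
    "\<And>x. x \<in> K \<Longrightarrow> L x = 1"
proof -
  let ?T = "K \<union> X closure_of (f `` A)"
  have "normal_space X"
    using compact Hausdorff compact_Hausdorff_or_regular_imp_normal_space by blast
  moreover have "closedin X (topspace X - A)" "closedin X ?T"
    using K A(1) by auto
  moreover have "disjnt (topspace X - A) ?T"
    using A(3) inward_closure[OF A(2)] interior_of_subset[of X A] unfolding disjnt_def by blast
  ultimately obtain L where L: "continuous_map X (top_of_set {0..1::real}) L"
    "L ` (topspace X - A) \<subseteq> {0}" "L ` ?T \<subseteq> {1}"
    using Urysohn_lemma[of X "topspace X - A" ?T 0 "1::real"] by auto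
  have "L y = 1" if "(x, y) \<in> f" "L x > 0" for x y
  proof -
    have "x \<in> A"
      using that L(2) f_subset by fastforce
    moreover have "f `` A \<subseteq> X closure_of (f `` A)"
      using f_subset by (intro closure_of_subset) auto
    ultimately show ?thesis
      using that(1) L(3) by blast
  qed
  then have "elem_lyapunov X f L"
    using L(1) unfolding elem_lyapunov_def by blast
  then show thesis using that L(2,3) by blast
qed

section \<open>Invariant sets and their traces\<close>

text \<open>A point of \<open>K\<close> ends a Conley step from \<open>K\<close>. The last
  \<open>f\<close>-step of it is exact and starts in \<open>K\<close>, because \<open>K\<close> is
  not left by Conley steps.\<close>

lemma invariant_f:
  assumes "invariant (conley X f) K"
  shows "f `` K = K"
proof
  show "f `` K \<subseteq> K"
    using assms f_subset_conley unfolding invariant_def by blast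
  show "K \<subseteq> f `` K"
  proof
    fix y assume "y \<in> K"
    then obtain x where x: "x \<in> K" "(x, y) \<in> conley X f"
      using assms unfolding invariant_def by blast
    then obtain a where "x = a \<or> (x, a) \<in> conley X f" "(a, y) \<in> f"
      using conley_last by blast
    then show "y \<in> f `` K"
      using x(1) assms unfolding invariant_def by blast
  qed
qed

text \<open>A cluster point of a backward \<open>\<C>f\<close>-orbit of a point of \<open>K\<close> is chain recurrent.\<close>

lemma invariant_eq_Image_trace:
  assumes K: "closedin X K" and inv: "invariant (conley X f) K"
  shows "conley X f `` (K \<inter> cyclic_set (conley X f)) = K"
proof
  have sub: "conley X f `` K \<subseteq> K" and sup: "K \<subseteq> conley X f `` K"
    using inv by (simp_all add: invariant_def)
  show "conley X f `` (K \<inter> cyclic_set (conley X f)) \<subseteq> K"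
    using sub by blast
  show "K \<subseteq> conley X f `` (K \<inter> cyclic_set (conley X f))"
  proof
    fix y assume y: "y \<in> K"
    \<comment> \<open>The clause for \<open>n = 0\<close> makes the backward orbit start at
      \<open>y\<close>.\<close>
    have "\<exists>g. \<forall>n. (g n \<in> K \<and> (n = 0 \<longrightarrow> g n = y)) \<and> (g (Suc n), g n) \<in> conley X f"
    proof (rule dependent_nat_choice)
      fix x :: 'a and n :: nat
      assume "x \<in> K \<and> (n = 0 \<longrightarrow> x = y)"
      then have "x \<in> conley X f `` K"
        using sup by blast
      then show "\<exists>z. (z \<in> K \<and> (Suc n = 0 \<longrightarrow> z = y)) \<and> (z, x) \<in> conley X f"
        by auto
    qed (use y in blast)
    then obtain g where "\<forall>n. (g n \<in> K \<and> (n = 0 \<longrightarrow> g n = y)) \<and> (g (Suc n), g n) \<in> conley X f" ..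
    then have g: "g n \<in> K" "g 0 = y" "(g (Suc n), g n) \<in> conley X f" for n
      by simp_all
    have step: "(g m, g n) \<in> conley X f" if "n < m" for m n :: nat
      using that
    proof (induction m)
      case (Suc m)
      show ?case
      proof (cases "n = m")
        case False
        then have "(g m, g n) \<in> conley X f"
          using Suc by simp
        then show ?thesis
          by (rule transD[OF trans_conley g(3)])
      qed (use g(3) in simp)
    qed simp
    \<comment> \<open>A point in all closures of tails is a cluster point of the orbit.\<close>
    define F where "F n = X closure_of (g ` {n..})" for n
    have gX: "g n \<in> topspace X" for n
      using g(1) closedin_subset[OF K] by blast
    have "F n \<noteq> {}" for n
      using closure_of_subset[of "g ` {n..}" X] gX unfolding F_def by blast
    moreover have "decseq F"
      unfolding F_def decseq_def by (intro allI impI closure_of_mono image_mono) auto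
    ultimately have "(\<Inter>n. F n) \<noteq> {}"
      using compact_space_imp_nest[OF compact, of F] unfolding F_def by auto
    then obtain x where x: "\<And>n. x \<in> F n" by blast
    have xK: "x \<in> K"
      using x[of 0] closure_of_minimal[OF _ K, of "g ` {0..}"] g(1) unfolding F_def by blast
    have xg: "(x, g n) \<in> conley X f" for n
    proof -
      \<comment> \<open>All later orbit points lead to \<open>g n\<close>, and the set of points
        that do so is closed; hence it contains the cluster point.\<close>
      have "F (Suc n) \<subseteq> {x. (x, g n) \<in> conley X f}"
        unfolding F_def using step closedin_converse_Image_singleton[OF conley_closed gX]
        by (intro closure_of_minimal) auto
      then show ?thesis using x by blast
    qed
    have "closedin X {x}"
      using Hausdorff xK closedin_subset[OF K] by (auto intro: closedin_Hausdorff_singleton)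
    \<comment> \<open>Now the closed set of points reached from \<open>x\<close> contains the whole
      orbit, hence also its cluster point \<open>x\<close>.\<close>
    then have "F 0 \<subseteq> conley X f `` {x}"
      unfolding F_def using xg closedin_conley_Image by (intro closure_of_minimal) auto
    then have "(x, x) \<in> conley X f"
      using x by blast
    then show "y \<in> conley X f `` (K \<inter> cyclic_set (conley X f))"
      using xK xg[of 0] g(2) unfolding cyclic_set_def by blast
  qed
qed

lemma Image_trace_eq_invariant:
  assumes "conley X f `` (K \<inter> cyclic_set (conley X f)) = K"
  shows "invariant (conley X f) K"
proof -
  have "conley X f `` K \<subseteq> conley X f `` (K \<inter> cyclic_set (conley X f))"
  proof
    fix z assume "z \<in> conley X f `` K"
    then obtain x y where "x \<in> K \<inter> cyclic_set (conley X f)" "(x, y) \<in> conley X f" "(y, z) \<in> conley X f"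
      using assms by blast
    then show "z \<in> conley X f `` (K \<inter> cyclic_set (conley X f))"
      using transD[OF trans_conley] by blast
  qed
  then show ?thesis
    unfolding invariant_def using assms by blast
qed

text \<open>This is the source of invariant sets below, with \<open>D\<close> a single chain
  recurrent point, the closure of an attractor, or a prescribed trace.\<close>

lemma conley_Image_invariant:
  assumes "D \<subseteq> conley X f `` D"
  shows "invariant (conley X f) (conley X f `` D)"
  unfolding invariant_def
proof
  show "conley X f `` conley X f `` D \<subseteq> conley X f `` D"
    using transD[OF trans_conley] by blast
  show "conley X f `` D \<subseteq> conley X f `` conley X f `` D"
    using assms by blast
qed

section \<open>Attractors and clopen traces\<close>

lemma assoc_attractor_subset: "assoc_attractor X f A \<subseteq> A"
  by (auto simp: assoc_attractor_def)

lemma assoc_attractor_upper: "B \<subseteq> A \<Longrightarrow> invariant (conley X f) B \<Longrightarrow> B \<subseteq> assoc_attractor X f A"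
  by (auto simp: assoc_attractor_def)

lemma assoc_attractor_invariant: "invariant (conley X f) (assoc_attractor X f A)"
proof -
  have "conley X f `` assoc_attractor X f A = \<Union>{conley X f `` B | B. B \<subseteq> A \<and> invariant (conley X f) B}"
    by (auto simp: assoc_attractor_def)
  also have "\<dots> = assoc_attractor X f A"
    unfolding assoc_attractor_def invariant_def by (rule arg_cong[of _ _ Union]) auto
  finally show ?thesis
    by (simp add: invariant_def)
qed

lemma assoc_attractor_interior:
  assumes "inward X f A"
  shows "X closure_of (assoc_attractor X f A) \<subseteq> X interior_of A"
proof -
  have "assoc_attractor X f A = f `` assoc_attractor X f A"
    using invariant_f[OF assoc_attractor_invariant] by simp
  also have "\<dots> \<subseteq> f `` A"
    using assoc_attractor_subset by blast
  finally show ?thesis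
    using inward_closure[OF assms] closure_of_mono by blast
qed

text \<open>The closure \<open>?D\<close> lies in its own Conley image, because that image is closed
  and contains the attractor. The image is therefore invariant; it stays in \<open>A\<close>, so
  maximality puts it, and with it \<open>?D\<close>, back into the attractor.\<close>

lemma assoc_attractor_closed:
  assumes A: "inward X f A"
  shows "closedin X (assoc_attractor X f A)"
proof -
  let ?B = "assoc_attractor X f A" and ?D = "X closure_of (assoc_attractor X f A)"
  have DA: "?D \<subseteq> A"
    using assoc_attractor_interior[OF A] interior_of_subset[of X A] by blast
  have BX: "?B \<subseteq> topspace X"
    using assoc_attractor_subset A unfolding inward_def by blast
  then have BD: "?B \<subseteq> ?D"
    by (rule closure_of_subset)
  have closedCD: "closedin X (conley X f `` ?D)"
    by (intro closedin_conley_Image closedin_closure_of)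
  have "?B \<subseteq> conley X f `` ?D"
    using assoc_attractor_invariant[of A] BD unfolding invariant_def by blast
  then have D: "?D \<subseteq> conley X f `` ?D"
    using closedCD by (rule closure_of_minimal)
  have "conley X f `` ?D \<subseteq> A"
    using DA inward_conley[OF A] by blast
  then have "conley X f `` ?D \<subseteq> ?B"
    using conley_Image_invariant[OF D] by (rule assoc_attractor_upper)
  then have "?B = ?D"
    using D BD by blast
  then show ?thesis
    by (metis closedin_closure_of)
qed

text \<open>The interior on the right shows that the trace is relatively open. A chain recurrent
  point of \<open>A\<close> belongs to its own Conley image, an invariant subset of
  \<open>A\<close>.\<close>

lemma assoc_attractor_trace:
  assumes A: "inward X f A"
  shows "assoc_attractor X f A \<inter> cyclic_set (conley X f) = X interior_of A \<inter> cyclic_set (conley X f)"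
proof
  have "assoc_attractor X f A \<subseteq> X closure_of (assoc_attractor X f A)"
    using assoc_attractor_closed[OF A] by (simp add: closure_of_closedin)
  then show "assoc_attractor X f A \<inter> cyclic_set (conley X f) \<subseteq> X interior_of A \<inter> cyclic_set (conley X f)"
    using assoc_attractor_interior[OF A] by blast
  show "X interior_of A \<inter> cyclic_set (conley X f) \<subseteq> assoc_attractor X f A \<inter> cyclic_set (conley X f)"
  proof
    fix x assume x: "x \<in> X interior_of A \<inter> cyclic_set (conley X f)"
    then have xx: "x \<in> A" "{x} \<subseteq> conley X f `` {x}"
      using interior_of_subset[of X A] by (auto simp: cyclic_set_def)
    have "conley X f `` {x} \<subseteq> A"
      using inward_conley[OF A] xx(1) by blast
    then have "conley X f `` {x} \<subseteq> assoc_attractor X f A"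
      using conley_Image_invariant[OF xx(2)] by (rule assoc_attractor_upper)
    then show "x \<in> assoc_attractor X f A \<inter> cyclic_set (conley X f)"
      using x xx(2) by blast
  qed
qed

lemma attractor_iff:
  "attractor X f K \<longleftrightarrow> closedin X K \<and> invariant (conley X f) K \<and>
     clopenin (subtopology X (cyclic_set (conley X f))) (K \<inter> cyclic_set (conley X f))"
proof
  assume "attractor X f K"
  then obtain A where A: "inward X f A" "K = assoc_attractor X f A"
    unfolding attractor_def by blast
  have "openin (subtopology X (cyclic_set (conley X f))) (K \<inter> cyclic_set (conley X f))"
    unfolding A(2) assoc_attractor_trace[OF A(1)]
    by (rule openin_subtopology_Int[OF openin_interior_of])
  moreover have "closedin (subtopology X (cyclic_set (conley X f))) (K \<inter> cyclic_set (conley X f))"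
    unfolding A(2) using closedin_subtopology_Int_closed[OF assoc_attractor_closed[OF A(1)]]
    by (subst Int_commute)
  ultimately show "closedin X K \<and> invariant (conley X f) K \<and>
      clopenin (subtopology X (cyclic_set (conley X f))) (K \<inter> cyclic_set (conley X f))"
    using assoc_attractor_closed[OF A(1)] assoc_attractor_invariant A(2)
    by (simp add: clopenin_def)
next
  let ?C = "cyclic_set (conley X f)"
  assume K: "closedin X K \<and> invariant (conley X f) K \<and> clopenin (subtopology X ?C) (K \<inter> ?C)"
  have "openin (subtopology X ?C) (K \<inter> ?C)"
    using K by (simp add: clopenin_def)
  then obtain O' where O': "openin X O'" "K \<inter> ?C = O' \<inter> ?C"
    unfolding openin_subtopology by blast
  \<comment> \<open>Adding all points that are not chain recurrent makes \<open>G\<close> contain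
    \<open>K\<close> while the two still have the same trace; \<open>G\<close> is open since the
    chain recurrent set is closed.\<close>
  define G where "G = O' \<union> (topspace X - ?C)"
  have "openin X G"
    unfolding G_def using O'(1) closedin_cyclic_set by blast
  moreover have "K \<subseteq> G"
    unfolding G_def using O'(2) K closedin_subset[of X K] by blast
  moreover have "conley X f `` K \<subseteq> K"
    using K unfolding invariant_def by simp
  ultimately obtain A where A: "openin X A" "inward X f A" "K \<subseteq> A" "A \<subseteq> G"
    using inward_nbhd K by metis
  \<comment> \<open>The attractor is determined by its trace, which lies in \<open>G\<close> and
    hence in \<open>K\<close>.\<close>
  have "assoc_attractor X f A = conley X f `` (assoc_attractor X f A \<inter> ?C)"
    using invariant_eq_Image_trace[OF assoc_attractor_closed[OF A(2)] assoc_attractor_invariant] by simp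
  also have "\<dots> \<subseteq> conley X f `` K"
    using assoc_attractor_subset[of A] A(4) O'(2) unfolding G_def by blast
  also have "\<dots> = K"
    using K unfolding invariant_def by simp
  finally have "K = assoc_attractor X f A"
    using assoc_attractor_upper[OF A(3)] K by blast
  then show "attractor X f K"
    unfolding attractor_def using A(2) by blast
qed

text \<open>As \<open>A\<close> consists of chain recurrent points, restricting the relation and
  restricting its image to such points agree. So invariance of \<open>A\<close> says that the image
  has trace \<open>A\<close>, and \<open>attractor_iff\<close> applies.\<close>

lemma clopen_trace_attractor:
  assumes clopen: "clopenin (subtopology X (cyclic_set (conley X f))) A"
    and inv: "invariant (conley_cyclic X f) A"
  shows "chain_trace X f (conley X f `` A) = A" "attractor X f (conley X f `` A)"
proof -
  let ?C = "cyclic_set (conley X f)"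
  have clA: "closedin (subtopology X ?C) A"
    using clopen by (simp add: clopenin_def)
  then have AC: "A \<subseteq> ?C"
    using closedin_subset by fastforce
  have A: "closedin X A"
    using closedin_trans_full[OF clA closedin_cyclic_set] .
  have "conley X f `` A \<inter> ?C = conley_cyclic X f `` A"
    using AC unfolding conley_cyclic_def by blast
  then have trace: "conley X f `` A \<inter> ?C = A"
    using inv by (simp add: invariant_def)
  then show "chain_trace X f (conley X f `` A) = A"
    by (simp add: chain_trace_def)
  have "A \<subseteq> conley X f `` A"
    using AC unfolding cyclic_set_def by blast
  then have "invariant (conley X f) (conley X f `` A)"
    by (rule conley_Image_invariant)
  then show "attractor X f (conley X f `` A)"
    using A clopen trace closedin_conley_Image by (simp add: attractor_iff)
qed

section \<open>Neighborhood bases, traces and the criterion by attractors\<close>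

lemma set_nbhd_base_inward:
  assumes "closedin X K" "conley X f `` K \<subseteq> K"
  shows "set_nbhd_base X K {A. openin X A \<and> inward X f A \<and> K \<subseteq> A}"
  unfolding set_nbhd_base_def
proof (intro conjI ballI allI impI)
  fix N assume "N \<in> {A. openin X A \<and> inward X f A \<and> K \<subseteq> A}"
  then have "openin X N" "K \<subseteq> N" by auto
  then show "set_nbhd X K N"
    using openin_subset[of X N] interior_of_openin[of X N] by (simp add: set_nbhd_def)
next
  fix N assume N: "set_nbhd X K N"
  then obtain A where "openin X A" "inward X f A" "K \<subseteq> A" "A \<subseteq> X interior_of N"
    using inward_nbhd[OF assms openin_interior_of, of N] unfolding set_nbhd_def by blast
  then show "\<exists>A\<in>{A. openin X A \<and> inward X f A \<and> K \<subseteq> A}. A \<subseteq> N"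
    using interior_of_subset[of X N] by blast
qed

lemma conley_cyclic_invariant_trace:
  assumes "conley X f `` K \<subseteq> K"
  shows "invariant (conley_cyclic X f) (K \<inter> cyclic_set (conley X f))"
  unfolding invariant_def
proof
  show "conley_cyclic X f `` (K \<inter> cyclic_set (conley X f)) \<subseteq> K \<inter> cyclic_set (conley X f)"
    using assms by (auto simp: conley_cyclic_def)
  show "K \<inter> cyclic_set (conley X f) \<subseteq> conley_cyclic X f `` (K \<inter> cyclic_set (conley X f))"
    by (auto simp: conley_cyclic_def cyclic_set_def)
qed

text \<open>If \<open>y\<close> in \<open>K\<close> had no predecessor in \<open>K\<close>, the
  points not leading to \<open>y\<close> would form an open neighborhood of \<open>K\<close>,
  containing an inward set \<open>A\<close> around \<open>K\<close>. But the attractor of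
  \<open>A\<close> contains \<open>y\<close>, hence also a predecessor of \<open>y\<close>.\<close>

lemma invariant_if_subset_attractors:
  assumes K: "closedin X K" "conley X f `` K \<subseteq> K"
    and attr: "\<And>A. inward X f A \<Longrightarrow> K \<subseteq> A \<Longrightarrow> K \<subseteq> assoc_attractor X f A"
  shows "invariant (conley X f) K"
  unfolding invariant_def
proof
  show "conley X f `` K \<subseteq> K" by fact
  show "K \<subseteq> conley X f `` K"
  proof (rule ccontr)
    assume "\<not> K \<subseteq> conley X f `` K"
    then obtain y where y: "y \<in> K" "y \<notin> conley X f `` K" by blast
    have "y \<in> topspace X"
      using y(1) closedin_subset[OF K(1)] by blast
    then have "openin X (topspace X - {x. (x, y) \<in> conley X f})"
      using closedin_converse_Image_singleton[OF conley_closed] by blast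
    moreover have "K \<subseteq> topspace X - {x. (x, y) \<in> conley X f}"
      using y(2) closedin_subset[OF K(1)] by blast
    ultimately obtain A where A: "inward X f A" "K \<subseteq> A" "A \<subseteq> topspace X - {x. (x, y) \<in> conley X f}"
      using inward_nbhd[OF K] by metis
    have "y \<in> conley X f `` assoc_attractor X f A"
      using attr[OF A(1,2)] y(1) assoc_attractor_invariant[of A] unfolding invariant_def by blast
    then show False
      using assoc_attractor_subset[of A] A(3) by blast
  qed
qed

end

theorem theorem6p24:
  fixes X :: "'a topology" and f :: "('a \<times> 'a) set" and K :: "'a set"
  assumes "compact_space X" and "Hausdorff_space X"
    and "closedin (prod_topology X X) f"
    and "K \<subseteq> topspace X"
  shows
    "(closedin X K \<and> plus_invariant (conley X f) K \<longrightarrow>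
        (\<forall>G. openin X G \<and> K \<subseteq> G \<longrightarrow>
           (\<exists>A. openin X A \<and> inward X f A \<and> K \<subseteq> A \<and> A \<subseteq> G) \<and>
           (\<exists>L. elem_lyapunov X f L \<and> (\<forall>x\<in>topspace X - G. L x = 0) \<and> (\<forall>x\<in>K. L x = 1))) \<and>
        set_nbhd_base X K {A. openin X A \<and> inward X f A \<and> K \<subseteq> A} \<and>
        closedin X (K \<inter> cyclic_set (conley X f)) \<and>
        closedin (subtopology X (cyclic_set (conley X f))) (K \<inter> cyclic_set (conley X f)) \<and>
        invariant (conley_cyclic X f) (K \<inter> cyclic_set (conley X f)))
   \<and> (closedin X K \<longrightarrow>
        ((plus_invariant (conley X f) K \<and> invariant f K) \<longleftrightarrow> invariant (conley X f) K) \<and>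
        (invariant (conley X f) K \<longleftrightarrow> K = conley X f `` (K \<inter> cyclic_set (conley X f))) \<and>
        (K = conley X f `` (K \<inter> cyclic_set (conley X f)) \<longleftrightarrow>
           plus_invariant (conley X f) K \<and>
           (\<forall>A. inward X f A \<and> K \<subseteq> A \<longrightarrow> K \<subseteq> assoc_attractor X f A)))
   \<and> (attractor X f K \<longleftrightarrow>
        closedin X K \<and> invariant (conley X f) K \<and>
        clopenin (subtopology X (cyclic_set (conley X f))) (K \<inter> cyclic_set (conley X f)))
   \<and> (\<forall>A\<^sub>0. clopenin (subtopology X (cyclic_set (conley X f))) A\<^sub>0 \<and>
             invariant (conley_cyclic X f) A\<^sub>0 \<longrightarrow>
        attractor X f (conley X f `` A\<^sub>0) \<and> chain_trace X f (conley X f `` A\<^sub>0) = A\<^sub>0)"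
proof -
  interpret compact_relation X f
    using assms by unfold_locales
  let ?C = "cyclic_set (conley X f)"
  have nbhd: "\<exists>A. openin X A \<and> inward X f A \<and> K \<subseteq> A \<and> A \<subseteq> G"
    if K: "closedin X K" "plus_invariant (conley X f) K" and G: "openin X G" "K \<subseteq> G" for G
  proof -
    have "conley X f `` K \<subseteq> K"
      using K(2) by (simp add: plus_invariant_def)
    then obtain A where "openin X A" "inward X f A" "K \<subseteq> A" "A \<subseteq> G"
      by (rule inward_nbhd[OF K(1) _ G])
    then show ?thesis by blast
  qed
  moreover have "\<exists>L. elem_lyapunov X f L \<and> (\<forall>x\<in>topspace X - G. L x = 0) \<and> (\<forall>x\<in>K. L x = 1)"
    if K: "closedin X K" "plus_invariant (conley X f) K" and G: "openin X G" "K \<subseteq> G" for G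
  proof -
    \<comment> \<open>The Lyapunov function is built for an inward set inside \<open>G\<close>;
      vanishing off that set, it vanishes off \<open>G\<close>.\<close>
    obtain A where A: "openin X A" "inward X f A" "K \<subseteq> A" "A \<subseteq> G"
      using nbhd[OF K G] by blast
    obtain L where "elem_lyapunov X f L" "\<And>x. x \<in> topspace X - A \<Longrightarrow> L x = 0"
      "\<And>x. x \<in> K \<Longrightarrow> L x = 1"
      using elem_lyapunov_exists[OF K(1) A(1-3)] by blast
    then show ?thesis using A(4) by blast
  qed
  moreover have "closedin X (K \<inter> ?C) \<and> closedin (subtopology X ?C) (K \<inter> ?C)" if "closedin X K"
    using closedin_Int[OF that closedin_cyclic_set] closedin_subset_topspace by fastforce
  moreover have "(plus_invariant (conley X f) K \<and> invariant f K) \<longleftrightarrow> invariant (conley X f) K"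
  proof
    assume *: "plus_invariant (conley X f) K \<and> invariant f K"
    then have "K \<subseteq> conley X f `` K"
      using Image_mono[OF f_subset_conley, of K K] by (simp add: invariant_def)
    then show "invariant (conley X f) K"
      using * by (simp add: invariant_def plus_invariant_def)
  next
    assume "invariant (conley X f) K"
    then show "plus_invariant (conley X f) K \<and> invariant f K"
      using invariant_f[of K] by (simp add: invariant_def plus_invariant_def)
  qed
  moreover have "invariant (conley X f) K \<longleftrightarrow> K = conley X f `` (K \<inter> ?C)" if "closedin X K"
    using invariant_eq_Image_trace[OF that] Image_trace_eq_invariant[of K] by metis
  \<comment> \<open>The attractor condition is compared with Conley invariance, to which the trace
    condition has been reduced as well; the equivalence of the two follows.\<close>
  moreover have "invariant (conley X f) K \<longleftrightarrow> plus_invariant (conley X f) K \<and>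
      (\<forall>A. inward X f A \<and> K \<subseteq> A \<longrightarrow> K \<subseteq> assoc_attractor X f A)" if "closedin X K"
  proof
    assume "invariant (conley X f) K"
    then show "plus_invariant (conley X f) K \<and>
        (\<forall>A. inward X f A \<and> K \<subseteq> A \<longrightarrow> K \<subseteq> assoc_attractor X f A)"
      using assoc_attractor_upper[of K] by (auto simp: plus_invariant_def invariant_def)
  next
    assume "plus_invariant (conley X f) K \<and>
        (\<forall>A. inward X f A \<and> K \<subseteq> A \<longrightarrow> K \<subseteq> assoc_attractor X f A)"
    then show "invariant (conley X f) K"
      using invariant_if_subset_attractors[OF that] by (simp add: plus_invariant_def)
  qed
  ultimately show ?thesis
    using set_nbhd_base_inward[of K] conley_cyclic_invariant_trace[of K] attractor_iff
      clopen_trace_attractor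
    by (simp add: plus_invariant_def)
qed

end
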